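(* Let $G(z)\in\mathbb{F}_2[z]^{k\times 2k}$ be a generator matrix, with rows $g_1(z),\dots,g_k(z)$, of a binary self-dual $(2k,k)$ convolutional code and let $a_i(z)\in\mathbb{F}_2[z]$ for $i\in\{1,\dots,k\}$. Then $$\tilde G(z)=\begin{pmatrix}a_1(z)&a_1(z)&g_1(z)\\ \vdots&\vdots&\vdots\\ a_k(z)&a_k(z)&g_k(z)\end{pmatrix}\in\mathbb{F}_2[z]^{k\times(2k+2)}$$ generates a binary self-orthogonal convolutional code.
   Context: A binary $(n,k)$ convolutional code is an $\mathbb{F}_2[z]$-submodule $\mathcal{C}\subset\mathbb{F}_2[z]^n$ of rank $k$. A generator matrix of $\mathcal{C}$ is a matrix in $\mathbb{F}_2[z]^{k\times n}$ whose rows form a basis of $\mathcal{C}$; one says it generates $\mathcal{C}$. The dual is $\mathcal{C}^\perp=\{f(z)\in\mathbb{F}_2[z]^n : f(z)c(z)^\top=0\ \forall c(z)\in\mathcal{C}\}$. $\mathcal{C}$ is self-orthogonal if $\mathcal{C}\subset\mathcal{C}^\perp$ and self-dual if $\mathcal{C}=\mathcal{C}^\perp$. *)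

theory Defs
  imports "HOL-Library.Z2" "Jordan_Normal_Form.VS_Connect"
begin

text \<open>
  The field with two elements is the type \<^typ>\<open>bit\<close>, so that \<^typ>\<open>bit poly\<close> is
  the polynomial ring $F_2[z]$, and $F_2[z]^n$ is the module \<open>F2z_module n\<close> with
  carrier \<open>carrier_vec n\<close>.
\<close>

abbreviation F2z_module :: "nat \<Rightarrow> (bit poly, bit poly vec) module" where
  "F2z_module n \<equiv> module_vec TYPE(bit poly) n"

text \<open>
  The library's \<open>vectorspace.basis\<close> is restricted to vector spaces over a field;
  the linear combinations, spans and linear independence below are those of
  modules over the ring $F_2[z]$.
\<close>

definition basis_of_submodule :: "nat \<Rightarrow> bit poly vec set \<Rightarrow> bit poly vec set \<Rightarrow> bool" where
  "basis_of_submodule n B C \<longleftrightarrow>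
     B \<subseteq> carrier_vec n \<and>
     LinearCombinations.module.lin_indpt class_ring (F2z_module n) B \<and>
     LinearCombinations.module.span class_ring (F2z_module n) B = C"

text \<open>
  Since $F_2[z]$ is a principal ideal domain, every submodule of $F_2[z]^n$ is free;
  its rank is the cardinality of a basis.
\<close>

definition convolutional_code :: "nat \<Rightarrow> nat \<Rightarrow> bit poly vec set \<Rightarrow> bool" where
  "convolutional_code n k C \<longleftrightarrow>
     submodule class_ring C (F2z_module n) \<and>
     (\<exists>B. finite B \<and> card B = k \<and> basis_of_submodule n B C)"

text \<open>
  Distinctness is required because the rows must be linearly independent as a family,
  whereas \<open>set (rows G)\<close> would hide a repeated row.
\<close>

definition generator_matrix :: "nat \<Rightarrow> nat \<Rightarrow> bit poly mat \<Rightarrow> bit poly vec set \<Rightarrow> bool" where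
  "generator_matrix n k G C \<longleftrightarrow>
     G \<in> carrier_mat k n \<and> distinct (rows G) \<and> basis_of_submodule n (set (rows G)) C"

definition dual_code :: "nat \<Rightarrow> bit poly vec set \<Rightarrow> bit poly vec set" where
  "dual_code n C = {f \<in> carrier_vec n. \<forall>c\<in>C. f \<bullet> c = 0}"

definition self_orthogonal :: "nat \<Rightarrow> bit poly vec set \<Rightarrow> bool" where
  "self_orthogonal n C \<longleftrightarrow> C \<subseteq> dual_code n C"

definition self_dual :: "nat \<Rightarrow> bit poly vec set \<Rightarrow> bool" where
  "self_dual n C \<longleftrightarrow> C = dual_code n C"

end

theory Submission
  imports Defs
begin

text \<open>
  Prefixing the columns does not change the bilinear form on the rows: the two new coordinates of
  rows \<open>i\<close> and \<open>j\<close> contribute \<open>a\<^sub>i a\<^sub>j + a\<^sub>i a\<^sub>j = 0\<close>.  Independence is inherited because dropping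
  these coordinates is a linear map taking the new rows injectively to those of \<open>G\<close>.
\<close>

context mod_hom
begin

text \<open>A dependency in \<open>B\<close> is pushed forward along \<open>f\<close>. Injectivity
  on \<open>B\<close> keeps distinct vectors from merging, so a nonzero coefficient cannot cancel in
  the image.\<close>

lemma lin_indpt_if_image_lin_indpt:
  assumes B: "B \<subseteq> carrier M" and inj: "inj_on f B" and indpt: "N.lin_indpt (f ` B)"
  shows "M.lin_indpt B"
proof
  assume "M.lin_dep B"
  then obtain A c v where A: "finite A" "A \<subseteq> B" and c: "c \<in> A \<rightarrow> carrier R"
    and zero: "M.lincomb c A = \<zero>\<^bsub>M\<^esub>" and v: "v \<in> A" "c v \<noteq> \<zero>\<^bsub>R\<^esub>"
    unfolding M.lin_dep_def by blast
  \<comment> \<open>Coefficients are moved to the image by inverting \<open>f\<close> on the finite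
    support \<open>A\<close> only.\<close>
  define d where "d = c \<circ> inv_into A f"
  have injA: "inj_on f A" using inj A(2) by (rule inj_on_subset)
  have df: "d (f x) = c x" if "x \<in> A" for x
    using injA that by (simp add: d_def)
  have AM: "A \<subseteq> carrier M" using A B by blast
  have fA: "f x \<in> carrier N" if "x \<in> A" for x using AM that by auto
  have cx: "c x \<in> carrier R" if "x \<in> A" for x using c that by auto
  have d: "d \<in> f ` A \<rightarrow> carrier R" using df cx by auto
  have "N.lincomb d (f ` A) = (\<Oplus>\<^bsub>N\<^esub>x\<in>A. d (f x) \<odot>\<^bsub>N\<^esub> f x)"
    unfolding N.lincomb_def by (rule N.M.finsum_reindex) (use df fA cx injA in auto)
  also have "\<dots> = (\<Oplus>\<^bsub>N\<^esub>x\<in>A. f (c x \<odot>\<^bsub>M\<^esub> x))"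
    by (rule N.M.finsum_cong') (use df fA cx AM in auto)
  also have "\<dots> = f (M.lincomb c A)"
    unfolding M.lincomb_def by (rule hom_sum[symmetric]) (use A AM cx in auto)
  also have "\<dots> = \<zero>\<^bsub>N\<^esub>" by (simp add: zero)
  finally have "N.lin_dep (f ` B)"
    using A v df d by (intro N.lin_dep_crit[where A = "f ` A" and a = d and v = "f v"]) auto
  with indpt show False by contradiction
qed

end

lemma mod_hom_vec_last:
  assumes "n \<le> m"
  shows "mod_hom class_ring (module_vec TYPE('a :: comm_ring_1) m) (module_vec TYPE('a) n)
    (\<lambda>v. vec_last v n)"
proof -
  interpret m: vec_module "TYPE('a)" m .
  interpret n: vec_module "TYPE('a)" n .
  have "(\<lambda>v. vec_last v n) \<in> LinearCombinations.module_hom class_ring m.V n.V"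
    using assms by (auto simp: LinearCombinations.module_hom_def module_vec_simps vec_last_def)
  then show ?thesis
    by (intro mod_hom.intro mod_hom_axioms.intro m.module_axioms n.module_axioms)
qed

text \<open>Stated for an arbitrary set \<open>S\<close>, so that minimality of the span extends
  orthogonality from generators to everything they generate.\<close>

lemma submodule_dual_code:
  assumes "S \<subseteq> carrier_vec n"
  shows "submodule class_ring (dual_code n S) (F2z_module n)"
proof -
  interpret vec_module "TYPE(bit poly)" n .
  show ?thesis
    using assms
    by (intro submodule.intro module_axioms)
      (auto simp: dual_code_def module_vec_simps add_scalar_prod_distrib[of _ n] subset_iff)
qed

text \<open>By bilinearity it suffices to test orthogonality on generators; minimality of the span
  is applied once in each argument of the form.\<close>

lemma span_self_orthogonal:
  assumes S: "S \<subseteq> dual_code n S"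
  shows "self_orthogonal n (LinearCombinations.module.span class_ring (F2z_module n) S)"
proof -
  interpret vec_module "TYPE(bit poly)" n .
  have carr: "S \<subseteq> carrier_vec n" using S by (auto simp: dual_code_def)
  have "span S \<subseteq> dual_code n S"
    using S submodule_dual_code[OF carr] by (rule span_is_subset)
  \<comment> \<open>Symmetry of the form swaps the two arguments, so the same span argument can be
    repeated.\<close>
  then have "S \<subseteq> dual_code n (span S)"
    using carr by (force simp: dual_code_def comm_scalar_prod[of _ n])
  then have "span S \<subseteq> dual_code n (span S)"
    using submodule_dual_code[OF span_is_subset2[OF carr]] by (rule span_is_subset)
  then show ?thesis by (simp add: self_orthogonal_def)
qed

text \<open>The set of rows is itself the basis witnessing the rank; distinctness makes its
  cardinality exactly \<open>k\<close>.\<close>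

lemma generator_matrix_span_rows:
  assumes "H \<in> carrier_mat k n" "distinct (rows H)"
    and "LinearCombinations.module.lin_indpt class_ring (F2z_module n) (set (rows H))"
  defines "C \<equiv> LinearCombinations.module.span class_ring (F2z_module n) (set (rows H))"
  shows "convolutional_code n k C" "generator_matrix n k H C"
proof -
  interpret vec_module "TYPE(bit poly)" n .
  have carr: "set (rows H) \<subseteq> carrier_vec n" using assms(1) rows_carrier[of H] by simp
  have basis: "basis_of_submodule n (set (rows H)) C"
    using assms carr by (simp add: basis_of_submodule_def)
  show "generator_matrix n k H C"
    using assms basis by (simp add: generator_matrix_def)
  have "card (set (rows H)) = k"
    using assms by (simp add: distinct_card)
  then show "convolutional_code n k C"
    using basis span_is_submodule[OF carr] by (auto simp: convolutional_code_def C_def)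
qed

theorem proposition4:
  fixes k :: nat and C :: "bit poly vec set" and G :: "bit poly mat" and a :: "nat \<Rightarrow> bit poly"
  assumes "convolutional_code (2 * k) k C"
    and "self_dual (2 * k) C"
    and "generator_matrix (2 * k) k G C"
  shows "\<exists>C'. convolutional_code (2 * k + 2) k C' \<and>
    generator_matrix (2 * k + 2) k
      (mat\<^sub>r k (2 * k + 2) (\<lambda>i. vec_of_list [a i, a i] @\<^sub>v row G i)) C' \<and>
    self_orthogonal (2 * k + 2) C'"
proof -
  define n where "n = 2 * k"
  define h where "h i = vec_of_list [a i, a i] @\<^sub>v row G i" for i
  define H where "H = mat\<^sub>r k (n + 2) h"
  interpret V: vec_module "TYPE(bit poly)" n .
  interpret W: vec_module "TYPE(bit poly)" "n + 2" .
  have G: "G \<in> carrier_mat k n" "distinct (rows G)" "V.lin_indpt (set (rows G))"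
    and span_G: "V.span (set (rows G)) = C"
    using assms(3) by (simp_all add: generator_matrix_def basis_of_submodule_def n_def)
  have g: "row G i \<in> carrier_vec n" if "i < k" for i using G(1) that by auto
  have h: "h i \<in> carrier_vec (n + 2)" if "i < k" for i
    using G(1) by (intro carrier_vecI) (simp add: h_def)
  have H: "H \<in> carrier_mat k (n + 2)" by (simp add: H_def)
  have rows_H: "rows H = map h [0..<k]"
    by (intro nth_equalityI) (use h in \<open>auto simp: H_def\<close>)
  have rows_G: "rows G = map (row G) [0..<k]"
    using G(1) by (simp add: rows_def)
  have last_h: "vec_last (h i) n = row G i" for i
    using G(1) by (intro eq_vecI) (auto simp: h_def vec_last_def)
  have map_rows: "map (\<lambda>v. vec_last v n) (rows H) = rows G"
    by (simp add: rows_H rows_G last_h)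
  \<comment> \<open>Distinctness of the projected list \<open>rows G\<close> yields both facts at
    once.\<close>
  then have inj: "distinct (rows H)" "inj_on (\<lambda>v. vec_last v n) (set (rows H))"
    using G(2) by (metis distinct_map)+
  interpret hom: mod_hom class_ring W.V V.V "\<lambda>v. vec_last v n"
    by (rule mod_hom_vec_last) simp
  \<comment> \<open>The projection maps \<open>set (rows H)\<close> onto
    \<open>set (rows G)\<close>, so independence is pulled back from \<open>G\<close>.\<close>
  have "W.lin_indpt (set (rows H))"
    using set_rows_carrier[OF H] inj(2) G(3)
    by (intro hom.lin_indpt_if_image_lin_indpt)
      (auto simp: module_vec_simps map_rows simp flip: set_map)
  note gen = generator_matrix_span_rows[OF H inj(1) this]
  have "row G i \<bullet> row G j = 0" if "i < k" "j < k" for i j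
  proof -
    \<comment> \<open>Rows lie in the code they span, and self-duality puts them in its dual as
      well.\<close>
    have "set (rows G) \<subseteq> C"
      using V.in_own_span[of "set (rows G)"] span_G G(1) rows_carrier[of G] by simp
    then have "row G i \<in> dual_code n C" "row G j \<in> C"
      using assms(2) that by (auto simp: rows_G self_dual_def n_def)
    then show ?thesis by (simp add: dual_code_def)
  qed
  moreover have "vec_of_list [x, x] \<bullet> vec_of_list [y, y] = 0" for x y :: "bit poly"
  proof -
    \<comment> \<open>The product below is \<open>x * y + x * y\<close>, which vanishes in
      characteristic two; this is checked coefficientwise after writing \<open>2\<close> as
      \<open>1 + 1\<close>.\<close>
    have "(2 :: bit poly) = 0"
      by (rule poly_eqI) (unfold one_add_one[symmetric] coeff_add, simp)
    then show ?thesis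
      by (simp add: scalar_prod_def)
  qed
  ultimately have "h i \<bullet> h j = 0" if "i < k" "j < k" for i j
    unfolding h_def using that g
    by (subst scalar_prod_append[of _ 2 _ n]) (auto intro: carrier_vecI)
  then have "set (rows H) \<subseteq> dual_code (n + 2) (set (rows H))"
    using h by (auto simp: dual_code_def rows_H)
  \<comment> \<open>The witness for \<open>C'\<close> is the span of the rows of
    \<open>H\<close>.\<close>
  then show ?thesis
    using gen span_self_orthogonal unfolding H_def h_def n_def by blast
qed

end
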